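(* For any $t\ge 0$, $$\sup_{\mu_0\in\mathcal P}\|\mu_t-\nu\|_{\mathrm{tv}}\ \le\ \sqrt{\frac{\eta[\varphi\varphi^*]}{(\varphi\varphi^*\eta)_\wedge}}\ \frac{\varphi_\vee}{\varphi_\wedge}\ \exp(-\tilde\lambda t),$$ where $\mathcal P$ is the set of probability measures on $S$.
   Context: Let $S$ be a finite set with at least two elements, $\bar S=S\sqcup\{\infty\}$, and let $\bar L=(\bar L(x,y))_{x,y\in\bar S}$ be a Markov generator on $\bar S$ (nonnegative off-diagonal entries, zero row sums) for which $\infty$ is absorbing. Put $V(x)=\bar L(x,\infty)\ge 0$ for $x\in S$; $V$ also denotes the diagonal matrix (multiplication operator). Let $L$ be the Markov generator on $S$ such that the $S\times S$ block of $\bar L$ is $L-V$. Standing assumption: $L$ is irreducible. Measures are row vectors, functions are column vectors, and $m[f]=\sum_x m(x)f(x)$. For a probability measure $\mu_0$ on $S$ and $t\ge0$, $\mu_t$ is the probability measure on $S$ given by $\mu_t[f]=\dfrac{\mu_0\,[e^{t(L-V)}f]}{\mu_0\,[e^{t(L-V)}\mathbf 1_S]}$ for $f:S\to\mathbb R$ (the law at time $t$ of the process with generator $\bar L$ started from $\mu_0$, conditioned on not being absorbed by time $t$). The quasi-stationary measure $\nu$ is the unique probability measure on $S$ such that $\mu_0=\nu$ implies $\mu_t=\nu$ for all $t\geq 0$. By Perron–Frobenius there is $\lambda_1\ge 0$, the eigenvalue of $V-L$ strictly less than the real parts of all its other (complex) eigenvalues, with $\nu(L-V)=-\lambda_1\nu$.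 Let $\eta$ be the unique invariant probability measure of $L$ (it charges every point), and let $L^*(x,y)=\frac{\eta(y)}{\eta(x)}L(y,x)$ be the adjoint of $L$ in $\mathbb L^2(\eta)$. Let $\varphi>0$ on $S$ satisfy $(L-V)\varphi=-\lambda_1\varphi$, normalized by $\eta[\varphi^2]=1$, and let $\varphi^*>0$ on $S$ satisfy $(L^*-V)\varphi^*=-\lambda_1\varphi^*$, normalized by $\eta[\varphi^*]=1$. For a positive function $f$ on $S$, $f_\wedge=\min_S f$ and $f_\vee=\max_S f$; in particular $(\varphi\varphi^*\eta)_\wedge=\min_{x\in S}\varphi(x)\varphi^*(x)\eta(x)$. $\tilde L$ is the Markov generator on $S$ with off-diagonal entries $\tilde L(x,y)=L(x,y)\frac{\varphi(y)}{\varphi(x)}$ for $x\ne y$ (diagonal entries determined by zero row sums); its invariant probability measure is $\tilde\eta(x)=\frac{\varphi(x)\varphi^*(x)\eta(x)}{\sum_{y\in S}\varphi(y)\varphi^*(y)\eta(y)}$. Let $\tilde L^\diamond=(\tilde L+\tilde L^* )/2$ where $\tilde L^*$ is the adjoint of $\tilde L$ in $\mathbb L^2(\tilde\eta)$; it is the Markov generator with off-diagonal entries, for $x\neq y$, $$\tilde L^\diamond(x,y)=\frac12\left(L(y,x)\frac{\varphi^*(y)\eta(y)}{\varphi^*(x)\eta(x)}+L(x,y)\frac{\varphi(y)}{\varphi(x)}\right).$$ $\tilde L^\diamond$ is self-adjoint in $\mathbb L^2(\tilde\eta)$ and irreducible; $\tilde\lambda>0$ denotes the smallest non-zero eigenvalue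 of $-\tilde L^\diamond$ (its spectral gap). For a signed measure $m$ on $S$ with $m(S)=0$, $\|m\|_{\mathrm{tv}}=\sum_{x\in S}|m(x)|$. *)

theory Defs
  imports "HOL-Analysis.Analysis"
begin

(* The finite state space is a finite type 's, extended by the cemetery None :: 's option.
   Measures and functions are both vectors real^'s; a measure m acts on a function f by the
   inner product m \<bullet> f, and m v* A, A *v f are the row and column actions of a matrix A. *)

definition markov_generator :: "real^'n^'n \<Rightarrow> bool" where
  "markov_generator G \<longleftrightarrow>
     (\<forall>x y. x \<noteq> y \<longrightarrow> 0 \<le> G $ x $ y) \<and> (\<forall>x. (\<Sum>y\<in>UNIV. G $ x $ y) = 0)"

definition absorbing :: "real^'n^'n \<Rightarrow> 'n \<Rightarrow> bool" where
  "absorbing G z \<longleftrightarrow> (\<forall>y. G $ z $ y = 0)"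

definition irreducible_generator :: "real^'n^'n \<Rightarrow> bool" where
  "irreducible_generator G \<longleftrightarrow> (\<forall>x y. (x, y) \<in> {(u, v). u \<noteq> v \<and> 0 < G $ u $ v}\<^sup>*)"

definition killing_rate :: "real^('s option)^('s option) \<Rightarrow> real^'s" where
  "killing_rate G = (\<chi> x. G $ Some x $ None)"

definition killed_block :: "real^('s option)^('s option) \<Rightarrow> real^'s^'s" where
  "killed_block G = (\<chi> x y. G $ Some x $ Some y)"

definition diag_mat :: "real^'n \<Rightarrow> real^'n^'n" where
  "diag_mat v = (\<chi> x y. if x = y then v $ x else 0)"

definition prob_measures :: "(real^'n) set" where
  "prob_measures = {m. (\<forall>x. 0 \<le> m $ x) \<and> (\<Sum>x\<in>UNIV. m $ x) = 1}"

definition invariant_prob :: "real^'n^'n \<Rightarrow> real^'n \<Rightarrow> bool" where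
  "invariant_prob G m \<longleftrightarrow> m \<in> prob_measures \<and> m v* G = 0"

(* The class-based exp is not available here: the type class multiplication on real^'n^'n is
   componentwise, while the product in the exponential series has to be **. *)
definition mat_exp :: "real^'n^'n \<Rightarrow> real^'n^'n" where
  "mat_exp A = (\<Sum>k. (1 / fact k) *\<^sub>R (((**) A) ^^ k) (mat 1))"

(* A is the sub-Markovian generator L - V; axis y 1 is the indicator function of {y}, and 1 is the
   constant function. *)
definition cond_law :: "real^'n^'n \<Rightarrow> real^'n \<Rightarrow> real \<Rightarrow> real^'n" where
  "cond_law A m t =
     (\<chi> y. (m \<bullet> (mat_exp (t *\<^sub>R A) *v axis y 1)) / (m \<bullet> (mat_exp (t *\<^sub>R A) *v 1)))"

lemma cond_law_inner:
  "cond_law A m t \<bullet> f = (m \<bullet> (mat_exp (t *\<^sub>R A) *v f)) / (m \<bullet> (mat_exp (t *\<^sub>R A) *v 1))"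
proof -
  define E where "E = mat_exp (t *\<^sub>R A)"
  have "E *v f = (\<Sum>y\<in>UNIV. f $ y *\<^sub>R (E *v axis y 1))"
    by (simp add: vec_eq_iff matrix_vector_mult_def axis_def if_distrib mult.commute
        cong: if_cong)
  then show ?thesis
    unfolding E_def [symmetric]
    by (simp add: cond_law_def E_def [symmetric] inner_vec_def [of "vec_lambda _" f]
        inner_sum_right sum_divide_distrib mult.commute)
qed

definition quasi_stationary :: "real^'n^'n \<Rightarrow> real^'n \<Rightarrow> bool" where
  "quasi_stationary A m \<longleftrightarrow> m \<in> prob_measures \<and> (\<forall>t\<ge>0. cond_law A m t = m)"

definition eigenvalue :: "'a::field^'n^'n \<Rightarrow> 'a \<Rightarrow> bool" where
  "eigenvalue A z \<longleftrightarrow> (\<exists>v. v \<noteq> 0 \<and> A *v v = z *s v)"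

definition complex_mat :: "real^'n^'n \<Rightarrow> complex^'n^'n" where
  "complex_mat A = (\<chi> x y. complex_of_real (A $ x $ y))"

definition principal_eigenvalue :: "real^'n^'n \<Rightarrow> real \<Rightarrow> bool" where
  "principal_eigenvalue A l \<longleftrightarrow>
     eigenvalue (complex_mat A) (complex_of_real l) \<and>
     (\<forall>z. eigenvalue (complex_mat A) z \<and> z \<noteq> complex_of_real l \<longrightarrow> l < Re z)"

(* the adjoint of G in L^2(m), for m charging every point *)
definition adjoint_gen :: "real^'n \<Rightarrow> real^'n^'n \<Rightarrow> real^'n^'n" where
  "adjoint_gen m G = (\<chi> x y. m $ y / m $ x * G $ y $ x)"

definition doob_transform :: "real^'n^'n \<Rightarrow> real^'n \<Rightarrow> real^'n^'n" where
  "doob_transform G h =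
     (\<chi> x y. if x = y then - (\<Sum>z\<in>UNIV - {x}. G $ x $ z * h $ z / h $ x)
            else G $ x $ y * h $ y / h $ x)"

definition additive_symm :: "real^'n \<Rightarrow> real^'n^'n \<Rightarrow> real^'n^'n" where
  "additive_symm m G = (1 / 2) *\<^sub>R (G + adjoint_gen m G)"

(* The generators this is applied to are self-adjoint in some L^2(m), hence have real spectrum. *)
definition spectral_gap :: "real^'n^'n \<Rightarrow> real" where
  "spectral_gap G = (LEAST l. l \<noteq> 0 \<and> eigenvalue (- G) l)"

definition tv_norm :: "real^'n \<Rightarrow> real" where
  "tv_norm m = (\<Sum>x\<in>UNIV. \<bar>m $ x\<bar>)"

definition vec_min :: "real^'n \<Rightarrow> real" where
  "vec_min f = Min (range (\<lambda>x. f $ x))"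

definition vec_max :: "real^'n \<Rightarrow> real" where
  "vec_max f = Max (range (\<lambda>x. f $ x))"

(* The class multiplication * on real^'n is the pointwise product of functions. *)
definition tilde_eta :: "real^'n \<Rightarrow> real^'n \<Rightarrow> real^'n \<Rightarrow> real^'n" where
  "tilde_eta \<eta> \<phi> \<phi>s = (\<chi> x. (\<phi> * \<phi>s * \<eta>) $ x / (\<Sum>y\<in>UNIV. (\<phi> * \<phi>s * \<eta>) $ y))"

end

theory Submission
  imports Defs
begin

text \<open>
  Fix \<open>f\<close> with \<open>\<bar>f\<bar> \<le> 1\<close>, put \<open>A = L - V\<close> and \<open>h = f - \<nu>[f]\<close>, so that
  \<open>\<mu>\<^sub>t[f] - \<nu>[f] = \<mu>\<^sub>0[exp (tA) h] / \<mu>\<^sub>0[exp (tA) 1]\<close>. Doob's transform turns the killed evolution into a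
  Markovian one: \<open>u = exp (\<lambda>\<^sub>1 t) (exp (tA) h) / \<phi>\<close> solves the backward equation of the transformed generator
  and is centred for its invariant measure \<open>e \<propto> \<phi> \<nu>\<close>. By the Poincare inequality of the additive
  symmetrisation, its norm in \<open>L\<^sup>2(e)\<close> decays at the rate of the spectral gap; the initial norm is at
  most \<open>1 / min \<phi>\<close>, because \<open>h\<close> has \<open>\<nu>\<close>-variance at most 1. The denominator is bounded from below
  by comparing the constant 1 with \<open>\<phi> / max \<phi>\<close>.
\<close>

subsection \<open>The matrix exponential\<close>

lemma matrix_power_scaleR:
  "(((**) (t *\<^sub>R A)) ^^ k) X = t ^ k *\<^sub>R (((**) (A :: real^'n^'n)) ^^ k) X"
  by (induction k)
    (simp_all add: vec_eq_iff matrix_matrix_mult_def sum_distrib_left algebra_simps)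

lemma bounded_linear_matrix_mult_right: "bounded_linear ((**) (A :: real^'n^'m))"
  by (rule linear_conv_bounded_linear[THEN iffD1], rule linearI)
    (simp_all add: matrix_add_ldistrib vec_eq_iff matrix_matrix_mult_def sum_distrib_left sum.distrib algebra_simps)

lemma summable_mat_exp:
  fixes A :: "real^'n^'n"
  shows "summable (\<lambda>k. (1 / fact k) *\<^sub>R (((**) A) ^^ k) (mat 1))"
proof -
  obtain K where K: "0 < K" "\<And>X :: real^'n^'n. norm (A ** X) \<le> norm X * K"
    using bounded_linear.pos_bounded[OF bounded_linear_matrix_mult_right[of A]] by blast
  have pow: "norm ((((**) A) ^^ k) (mat 1)) \<le> norm (mat 1 :: real^'n^'n) * K ^ k" for k
  proof (induction k)
    case (Suc k)
    have "norm ((((**) A) ^^ Suc k) (mat 1)) \<le> norm ((((**) A) ^^ k) (mat 1)) * K"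
      using K(2) by simp
    also have "\<dots> \<le> norm (mat 1 :: real^'n^'n) * K ^ k * K"
      using Suc K(1) by (simp add: mult_right_mono)
    finally show ?case by (simp add: algebra_simps)
  qed simp
  show ?thesis
  proof (rule summable_comparison_test')
    show "summable (\<lambda>k. norm (mat 1 :: real^'n^'n) * (inverse (fact k) * K ^ k))"
      by (intro summable_mult summable_exp)
    show "norm ((1 / fact k) *\<^sub>R (((**) A) ^^ k) (mat 1))
        \<le> norm (mat 1 :: real^'n^'n) * (inverse (fact k) * K ^ k)" for k
      using pow[of k] by (simp add: field_simps)
  qed
qed

lemma mat_exp_nth_sums:
  fixes A :: "real^'n^'n"
  shows "(\<lambda>k. ((((**) A) ^^ k) (mat 1) $ x $ y / fact k) * t ^ k) sums (mat_exp (t *\<^sub>R A) $ x $ y)"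
proof -
  have bl: "bounded_linear (\<lambda>X :: real^'n^'n. X $ x $ y)"
    by (intro bounded_linear_compose[OF bounded_linear_vec_nth] bounded_linear_vec_nth)
  have "(\<lambda>k. ((1 / fact k) *\<^sub>R (((**) (t *\<^sub>R A)) ^^ k) (mat 1)) $ x $ y) sums (mat_exp (t *\<^sub>R A) $ x $ y)"
    unfolding mat_exp_def
    by (intro bounded_linear.sums[OF bl] summable_sums summable_mat_exp)
  then show ?thesis
    by (simp add: matrix_power_scaleR mult_ac)
qed

lemma mat_exp_zero: "mat_exp (0 *\<^sub>R (A :: real^'n^'n)) = mat 1"
proof -
  have "mat_exp (0 *\<^sub>R A) $ x $ y = mat 1 $ x $ y" for x y
    using sums_unique2[OF mat_exp_nth_sums[of A x y 0] powser_sums_zero] by simp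
  then show ?thesis by (simp add: vec_eq_iff)
qed

lemma has_real_derivative_mat_exp_nth:
  fixes A :: "real^'n^'n"
  shows "((\<lambda>s. mat_exp (s *\<^sub>R A) $ x $ y) has_real_derivative (A ** mat_exp (t *\<^sub>R A)) $ x $ y) (at t)"
proof -
  define c where "c x y k = (((**) A) ^^ k) (mat 1) $ x $ y / fact k" for x y k
  have c: "(\<lambda>k. c x y k * s ^ k) sums (mat_exp (s *\<^sub>R A) $ x $ y)" for x y s
    using mat_exp_nth_sums unfolding c_def by blast
  have "((\<lambda>s. \<Sum>k. c x y k * s ^ k) has_real_derivative (\<Sum>k. diffs (c x y) k * t ^ k)) (at t)"
    by (rule termdiffs_strong_converges_everywhere) (use c in \<open>auto simp: sums_iff\<close>)
  moreover have "diffs (c x y) k * t ^ k = (\<Sum>z\<in>UNIV. A $ x $ z * (c z y k * t ^ k))" for k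
    unfolding diffs_def c_def
    by (simp add: matrix_matrix_mult_def sum_distrib_left sum_distrib_right sum_divide_distrib
        field_simps del: of_nat_Suc)
  moreover have "(\<lambda>k. \<Sum>z\<in>UNIV. A $ x $ z * (c z y k * t ^ k)) sums
      (\<Sum>z\<in>UNIV. A $ x $ z * mat_exp (t *\<^sub>R A) $ z $ y)"
    by (intro sums_sum sums_mult c)
  ultimately show ?thesis
    using c by (simp add: sums_iff matrix_matrix_mult_def)
qed

lemma has_real_derivative_mat_exp_mult_vec:
  fixes A :: "real^'n^'n"
  shows "((\<lambda>s. (mat_exp (s *\<^sub>R A) *v h) $ x) has_real_derivative
     (A *v (mat_exp (t *\<^sub>R A) *v h)) $ x) (at t)"
  unfolding matrix_vector_mul_assoc
  by (simp only: matrix_vector_mult_def[of _ h] vec_lambda_beta)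
    (intro DERIV_sum DERIV_cmult_right has_real_derivative_mat_exp_nth)

subsection \<open>Linear differential inequalities\<close>

lemma gronwall:
  fixes q q' :: "real \<Rightarrow> real"
  assumes q: "\<And>s. (q has_real_derivative q' s) (at s)"
    and q': "\<And>s. 0 \<le> s \<Longrightarrow> q' s \<le> C * q s"
    and t: "0 \<le> t"
  shows "q t \<le> q 0 * exp (C * t)"
proof -
  have "q t * exp (- C * t) \<le> q 0 * exp (- C * 0)"
  proof (rule DERIV_nonpos_imp_nonincreasing[OF t])
    fix s assume "0 \<le> s" "s \<le> t"
    have "((\<lambda>s. q s * exp (- C * s)) has_real_derivative (q' s - C * q s) * exp (- C * s)) (at s)"
      by (auto intro!: derivative_eq_intros q simp: algebra_simps)
    moreover have "(q' s - C * q s) * exp (- C * s) \<le> 0"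
      using q'[OF \<open>0 \<le> s\<close>] by (simp add: mult_nonpos_nonneg)
    ultimately show "\<exists>y. ((\<lambda>s. q s * exp (- C * s)) has_real_derivative y) (at s) \<and> y \<le> 0"
      by blast
  qed
  then show ?thesis
    by (simp add: exp_minus field_simps)
qed

lemma has_real_derivative_min_0_power2:
  "((\<lambda>r. (min r 0)\<^sup>2) has_real_derivative 2 * min r 0) (at (r :: real))"
proof -
  consider "r < 0" | "r > 0" | "r = 0" by linarith
  then show ?thesis
  proof cases
    case 1
    have "((\<lambda>r. r\<^sup>2) has_real_derivative 2 * min r 0) (at r)"
      using 1 by (auto intro!: derivative_eq_intros)
    then show ?thesis
      by (rule has_field_derivative_transform_within_open[where S = "{..<0}"]) (use 1 in auto)
  next
    case 2
    have "((\<lambda>r. 0) has_real_derivative 2 * min r 0) (at r)"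
      using 2 by (auto intro!: derivative_eq_intros)
    then show ?thesis
      by (rule has_field_derivative_transform_within_open[where S = "{0<..}"]) (use 2 in auto)
  next
    case 3
    have "(\<lambda>h. (min h 0)\<^sup>2 / h) \<midarrow>0\<rightarrow> (0 :: real)"
    proof (rule Lim_null_comparison)
      have "norm ((min h 0)\<^sup>2 / h) \<le> \<bar>h\<bar>" for h :: real
        by (cases "h = 0") (auto simp: min_def power2_eq_square)
      then show "\<forall>\<^sub>F h in at 0. norm ((min h 0)\<^sup>2 / h) \<le> \<bar>h :: real\<bar>"
        by simp
      show "(\<lambda>h. \<bar>h :: real\<bar>) \<midarrow>0\<rightarrow> 0"
        by (auto intro!: tendsto_eq_intros)
    qed
    then show ?thesis
      using 3 by (simp add: DERIV_def)
  qed
qed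

lemma linear_ode_nonneg:
  fixes B :: "real^'n^'n" and z :: "real \<Rightarrow> real^'n"
  assumes z: "\<And>s x. ((\<lambda>s. z s $ x) has_real_derivative (B *v z s) $ x) (at s)"
    and B: "\<And>x y. x \<noteq> y \<Longrightarrow> 0 \<le> B $ x $ y"
    and z0: "\<And>x. 0 \<le> z 0 $ x"
    and t: "0 \<le> t"
  shows "0 \<le> z t $ x"
proof -
  text \<open>Since \<open>B\<close> is nonnegative off the diagonal, the squared negative part satisfies a Gronwall inequality.\<close>
  define m where "m s = (\<chi> x. min (z s $ x) 0)" for s
  define q where "q s = (\<Sum>x\<in>UNIV. (m s $ x)\<^sup>2)" for s
  have q: "(q has_real_derivative (\<Sum>x\<in>UNIV. 2 * m s $ x * (B *v z s) $ x)) (at s)" for s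
    unfolding q_def m_def vec_lambda_beta
    by (intro DERIV_sum DERIV_chain2[OF has_real_derivative_min_0_power2 z])
  obtain K where K: "\<And>v. norm (B *v v) \<le> norm v * K"
    using bounded_linear.bounded[OF matrix_vector_mul_bounded_linear[of B]] by blast
  have "(\<Sum>x\<in>UNIV. 2 * m s $ x * (B *v z s) $ x) \<le> 2 * K * q s" for s
  proof -
    have "m s $ x * (B $ x $ y * z s $ y) \<le> m s $ x * (B $ x $ y * m s $ y)" for x y
    proof (cases "x = y")
      case False
      then show ?thesis
        using B[OF False] by (intro mult_left_mono_neg mult_left_mono) (auto simp: m_def)
    qed (auto simp: m_def min_def)
    then have "m s \<bullet> (B *v z s) \<le> m s \<bullet> (B *v m s)"
      by (auto simp: inner_vec_def matrix_vector_mult_def sum_distrib_left intro!: sum_mono)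
    also have "\<dots> \<le> norm (m s) * (norm (m s) * K)"
      by (rule order_trans[OF norm_cauchy_schwarz mult_left_mono[OF K]]) simp
    also have "\<dots> = K * (m s \<bullet> m s)"
      by (simp add: power2_norm_eq_inner[symmetric] power2_eq_square)
    finally have "2 * (m s \<bullet> (B *v z s)) \<le> 2 * K * (m s \<bullet> m s)"
      by simp
    then show ?thesis
      by (simp add: q_def inner_vec_def power2_eq_square sum_distrib_left mult.assoc)
  qed
  from gronwall[OF q this t] have "q t \<le> 0"
    using z0 by (simp add: q_def m_def min_absorb2)
  then have "q t = 0"
    by (simp add: q_def sum_nonneg order_antisym)
  then have "m t $ x = 0"
    by (simp add: q_def sum_nonneg_eq_0_iff)
  then show ?thesis
    by (simp add: m_def min_def split: if_splits)
qed

subsection \<open>Irreducible generators\<close>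

lemma irreducible_generator_induct:
  assumes "irreducible_generator G" "P x"
    and "\<And>u v. P u \<Longrightarrow> u \<noteq> v \<Longrightarrow> 0 < G $ u $ v \<Longrightarrow> P v"
  shows "P y"
proof -
  have "(x, y) \<in> {(u, v). u \<noteq> v \<and> 0 < G $ u $ v}\<^sup>*"
    using assms(1) by (simp add: irreducible_generator_def)
  then show ?thesis
    by (induction rule: rtrancl_induct) (use assms(2,3) in auto)
qed

lemma irreducible_generator_back_induct:
  assumes "irreducible_generator G" "P y"
    and "\<And>u v. P v \<Longrightarrow> u \<noteq> v \<Longrightarrow> 0 < G $ u $ v \<Longrightarrow> P u"
  shows "P x"
proof -
  have "(x, y) \<in> {(u, v). u \<noteq> v \<and> 0 < G $ u $ v}\<^sup>*"
    using assms(1) by (simp add: irreducible_generator_def)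
  then show ?thesis
    by (induction rule: converse_rtrancl_induct) (use assms(2,3) in auto)
qed

lemma irreducible_generator_mono:
  assumes "irreducible_generator G" "\<And>x y. x \<noteq> y \<Longrightarrow> 0 < G $ x $ y \<Longrightarrow> 0 < H $ x $ y"
  shows "irreducible_generator H"
proof -
  have "{(u, v). u \<noteq> v \<and> 0 < G $ u $ v}\<^sup>* \<subseteq> {(u, v). u \<noteq> v \<and> 0 < H $ u $ v}\<^sup>*"
    by (rule rtrancl_mono) (use assms(2) in auto)
  with assms(1) show ?thesis
    unfolding irreducible_generator_def by blast
qed

lemma nonneg_left_eigenvector_zero:
  assumes "irreducible_generator A"
    and A: "\<And>x y. x \<noteq> y \<Longrightarrow> 0 \<le> A $ x $ y"
    and m: "\<And>x. 0 \<le> m $ x" "m v* A = l *\<^sub>R m"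
    and "m $ x0 = 0"
  shows "m = 0"
proof -
  have "m $ x = 0" for x
  proof (rule irreducible_generator_back_induct[where P = "\<lambda>x. m $ x = 0", OF assms(1,5)])
    fix u v assume v: "m $ v = 0" and uv: "u \<noteq> v" "0 < A $ u $ v"
    have "(\<Sum>x\<in>UNIV. m $ x * A $ x $ v) = 0"
      using arg_cong[OF m(2), of "\<lambda>w. w $ v"] v by (simp add: vector_matrix_mult_def mult.commute)
    moreover have "0 \<le> m $ x * A $ x $ v" for x
      using A[of x v] m(1)[of x] v by (cases "x = v") auto
    ultimately have "m $ u * A $ u $ v = 0"
      by (simp add: sum_nonneg_eq_0_iff)
    then show "m $ u = 0" using uv by simp
  qed
  then show ?thesis by (simp add: vec_eq_iff)
qed

lemma nonneg_left_eigenvector_unique: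
  fixes A :: "real^'n^'n"
  assumes A: "irreducible_generator A" "\<And>x y. x \<noteq> y \<Longrightarrow> 0 \<le> A $ x $ y"
    and m: "m v* A = l *\<^sub>R m"
    and r: "\<And>x. 0 < r $ x" "r v* A = l *\<^sub>R r"
  obtains c where "m = c *\<^sub>R r"
proof -
  text \<open>Subtracting the largest multiple of \<open>r\<close> that keeps \<open>m\<close> nonnegative creates a zero.\<close>
  define c where "c = Min (range (\<lambda>x. m $ x / r $ x))"
  have "c \<in> range (\<lambda>x. m $ x / r $ x)"
    unfolding c_def by (intro Min_in) auto
  then obtain x0 where x0: "c = m $ x0 / r $ x0" by blast
  have "c \<le> m $ x / r $ x" for x
    unfolding c_def by (intro Min_le) auto
  then have "c * r $ x \<le> m $ x" for x
    using r(1) by (simp add: field_simps)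
  moreover have "(m - c *\<^sub>R r) v* A = l *\<^sub>R (m - c *\<^sub>R r)"
    using m r(2) by (simp add: vec_eq_iff vector_matrix_mult_def sum_subtractf algebra_simps
        flip: sum_distrib_left)
  moreover have "(m - c *\<^sub>R r) $ x0 = 0"
    using r(1)[of x0] by (simp add: x0)
  ultimately have "m - c *\<^sub>R r = 0"
    by (intro nonneg_left_eigenvector_zero[OF A]) auto
  then show ?thesis by (intro that[of c]) simp
qed

subsection \<open>The Poincare inequality\<close>

lemma quadratic_nonneg_imp_linear_zero:
  fixes \<beta> \<gamma> :: real
  assumes "\<And>s. 0 \<le> 2 * s * \<beta> + s\<^sup>2 * \<gamma>"
  shows "\<beta> = 0"
proof (rule ccontr)
  assume "\<beta> \<noteq> 0"
  define k where "k = 1 / (\<bar>\<gamma>\<bar> + 1)"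
  have k: "0 < k" "k * \<gamma> < 1"
    by (auto simp: k_def field_simps)
  have "0 \<le> 2 * (- k * \<beta>) * \<beta> + (- k * \<beta>)\<^sup>2 * \<gamma>"
    by (rule assms)
  also have "\<dots> = k * \<beta>\<^sup>2 * (k * \<gamma> - 2)"
    by (simp add: power2_eq_square algebra_simps)
  also have "\<dots> < 0"
    using k \<open>\<beta> \<noteq> 0\<close> by (intro mult_pos_neg) auto
  finally show False by simp
qed

lemma dirichlet_form_eq:
  fixes G :: "real^'n^'n"
  assumes sym: "\<And>x y. e $ x * G $ x $ y = e $ y * G $ y $ x"
    and G: "markov_generator G"
  shows "- ((e * f) \<bullet> (G *v f)) = (\<Sum>x\<in>UNIV. \<Sum>y\<in>UNIV. e $ x * G $ x $ y * (f $ x - f $ y)\<^sup>2) / 2"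
proof -
  have row: "(\<Sum>y\<in>UNIV. G $ x $ y) = 0" for x
    using G by (simp add: markov_generator_def)
  have 1: "(\<Sum>x\<in>UNIV. \<Sum>y\<in>UNIV. e $ x * G $ x $ y * (f $ x)\<^sup>2) = 0"
    by (simp flip: sum_distrib_left sum_distrib_right add: row)
  have "(\<Sum>x\<in>UNIV. \<Sum>y\<in>UNIV. e $ x * G $ x $ y * (f $ y)\<^sup>2)
      = (\<Sum>x\<in>UNIV. \<Sum>y\<in>UNIV. e $ y * G $ y $ x * (f $ y)\<^sup>2)"
    by (simp only: sym)
  also have "\<dots> = 0"
    by (subst sum.swap) (rule 1)
  finally have 2: "(\<Sum>x\<in>UNIV. \<Sum>y\<in>UNIV. e $ x * G $ x $ y * (f $ y)\<^sup>2) = 0" .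
  have "(\<Sum>x\<in>UNIV. \<Sum>y\<in>UNIV. e $ x * G $ x $ y * (f $ x - f $ y)\<^sup>2)
     = (\<Sum>x\<in>UNIV. \<Sum>y\<in>UNIV. e $ x * G $ x $ y * (f $ x)\<^sup>2)
     + (\<Sum>x\<in>UNIV. \<Sum>y\<in>UNIV. e $ x * G $ x $ y * (f $ y)\<^sup>2)
     - 2 * ((e * f) \<bullet> (G *v f))"
    by (simp add: inner_vec_def matrix_vector_mult_def power2_diff sum_distrib_left
        algebra_simps sum.distrib sum_subtractf)
  then show ?thesis
    using 1 2 by simp
qed

lemma dirichlet_form_zero_imp_constant:
  fixes G :: "real^'n^'n"
  assumes e: "\<And>x. 0 < e $ x"
    and sym: "\<And>x y. e $ x * G $ x $ y = e $ y * G $ y $ x"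
    and G: "markov_generator G" "irreducible_generator G"
    and "(e * f) \<bullet> (G *v f) = 0"
  shows "f $ x = f $ y"
proof -
  have nn: "0 \<le> e $ x * G $ x $ y * (f $ x - f $ y)\<^sup>2" for x y
    using e[of x] G(1) by (cases "x = y") (auto simp: markov_generator_def)
  have "(\<Sum>x\<in>UNIV. \<Sum>y\<in>UNIV. e $ x * G $ x $ y * (f $ x - f $ y)\<^sup>2) = 0"
    using dirichlet_form_eq[OF sym G(1), of f] assms(5) by simp
  then have "e $ x * G $ x $ y * (f $ x - f $ y)\<^sup>2 = 0" for x y
    using nn by (simp add: sum_nonneg_eq_0_iff sum_nonneg) blast
  then have step: "f $ u = f $ v" if "0 < G $ u $ v" for u v
    using e[of u] that by (metis eq_iff_diff_eq_0 less_irrefl mult_eq_0_iff zero_eq_power2)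
  show ?thesis
    by (rule irreducible_generator_induct[where P = "\<lambda>y. f $ x = f $ y", OF G(2)])
      (auto dest: step)
qed

lemma spectral_gap_poincare:
  fixes G :: "real^'n^'n"
  assumes card: "2 \<le> CARD('n)"
    and e: "\<And>x. 0 < e $ x"
    and sym: "\<And>x y. e $ x * G $ x $ y = e $ y * G $ y $ x"
    and G: "markov_generator G" "irreducible_generator G"
    and f: "e \<bullet> f = 0"
  shows "spectral_gap G * ((e * f) \<bullet> f) \<le> - ((e * f) \<bullet> (G *v f))"
proof -
  define D where "D f g = - ((e * f) \<bullet> (G *v g))" for f g
  define N where "N f g = (e * f) \<bullet> g" for f g
  have D_commute: "D f g = D g f" for f g
  proof -
    have "(e * f) \<bullet> (G *v g) = (\<Sum>x\<in>UNIV. \<Sum>y\<in>UNIV. e $ x * G $ x $ y * f $ x * g $ y)"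
      by (simp add: inner_vec_def matrix_vector_mult_def sum_distrib_left mult_ac)
    also have "\<dots> = (\<Sum>x\<in>UNIV. \<Sum>y\<in>UNIV. e $ y * G $ y $ x * f $ x * g $ y)"
      by (simp only: sym)
    also have "\<dots> = (e * g) \<bullet> (G *v f)"
      by (subst sum.swap) (simp add: inner_vec_def matrix_vector_mult_def sum_distrib_left mult_ac)
    finally show ?thesis by (simp add: D_def)
  qed
  have N_commute: "N f g = N g f" for f g
    by (simp add: N_def inner_vec_def mult_ac)
  have D_expand: "D (f + s *\<^sub>R g) (f + s *\<^sub>R g) = D f f + 2 * s * D f g + s\<^sup>2 * D g g" for f g s
  proof -
    have "D (f + s *\<^sub>R g) (f + s *\<^sub>R g) = D f f + s * D f g + s * D g f + s\<^sup>2 * D g g"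
      by (simp add: D_def matrix_vector_right_distrib matrix_vector_mult_scaleR inner_add_right
          inner_add_left distrib_left power2_eq_square algebra_simps)
    then show ?thesis by (simp add: D_commute[of g f])
  qed
  have N_expand: "N (f + s *\<^sub>R g) (f + s *\<^sub>R g) = N f f + 2 * s * N f g + s\<^sup>2 * N g g" for f g s
  proof -
    have "N (f + s *\<^sub>R g) (f + s *\<^sub>R g) = N f f + s * N f g + s * N g f + s\<^sup>2 * N g g"
      by (simp add: N_def inner_add_right inner_add_left distrib_left power2_eq_square algebra_simps)
    then show ?thesis by (simp add: N_commute[of g f])
  qed
  have N_eq: "N f f = (\<Sum>x\<in>UNIV. e $ x * (f $ x)\<^sup>2)" for f
    by (simp add: N_def inner_vec_def power2_eq_square mult_ac)
  have N_pos: "0 < N f f" if nz: "f \<noteq> 0" for f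
  proof -
    obtain x where "f $ x \<noteq> 0"
      using nz by (metis vec_eq_iff zero_index)
    then show ?thesis
      unfolding N_eq using e by (intro sum_pos2[of _ x]) (auto simp: less_imp_le)
  qed

  text \<open>
    A minimiser of the Rayleigh quotient over the functions of mean zero is an eigenfunction, so the
    minimum is the least non-zero eigenvalue.
  \<close>
  define S where "S = sphere 0 1 \<inter> {f. e \<bullet> f = 0}"
  have "compact S"
    unfolding S_def by (intro compact_Int_closed compact_sphere closed_hyperplane)
  moreover have "S \<noteq> {}"
  proof -
    have "\<not> CARD('n) \<le> 1" using card by simp
    then obtain a b :: 'n where ab: "a \<noteq> b"
      by (auto simp: card_le_Suc0_iff_eq)
    define w where "w = e $ b *\<^sub>R axis a 1 - e $ a *\<^sub>R axis b (1 :: real)"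
    have "w $ a \<noteq> 0" using ab e[of b] by (simp add: w_def axis_def)
    then have "w \<noteq> 0" by auto
    moreover have "e \<bullet> w = 0"
      by (simp add: w_def inner_diff_right inner_axis)
    ultimately have "(1 / norm w) *\<^sub>R w \<in> S"
      by (simp add: S_def)
    then show ?thesis by blast
  qed
  moreover have "continuous_on S (\<lambda>f. D f f / N f f)"
  proof -
    have "N f f \<noteq> 0" if "f \<in> S" for f
      using N_pos[of f] that by (cases "f = 0") (auto simp: S_def)
    moreover have "continuous_on S (\<lambda>f. N f f)"
      unfolding N_eq by (intro continuous_intros)
    moreover have "continuous_on S (\<lambda>f. D f f)"
      unfolding D_def inner_vec_def matrix_vector_mult_def vec_lambda_beta times_vec_def inner_real_def
      by (intro continuous_intros)
    ultimately show ?thesis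
      by (intro continuous_on_divide) auto
  qed
  ultimately obtain f0 where f0: "f0 \<in> S" and f0_min: "\<And>f. f \<in> S \<Longrightarrow> D f0 f0 / N f0 f0 \<le> D f f / N f f"
    using continuous_attains_inf[of S "\<lambda>f. D f f / N f f"] by blast
  define l where "l = D f0 f0 / N f0 f0"
  have f0': "f0 \<noteq> 0" "e \<bullet> f0 = 0"
    using f0 by (auto simp: S_def)
  have D_f0: "D f0 f0 = l * N f0 f0"
    using N_pos[OF f0'(1)] by (simp add: l_def)
  have rayleigh: "l * N f f \<le> D f f" if "e \<bullet> f = 0" for f
  proof (cases "f = 0")
    case False
    let ?g = "(1 / norm f) *\<^sub>R f"
    have "?g \<in> S" using False that by (simp add: S_def)
    then have "l * N ?g ?g \<le> D ?g ?g"
      using f0_min[of ?g] N_pos[of ?g] False by (simp add: l_def pos_le_divide_eq)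
    moreover have "N ?g ?g = (1 / norm f)\<^sup>2 * N f f" "D ?g ?g = (1 / norm f)\<^sup>2 * D f f"
      by (simp_all add: N_def D_def matrix_vector_mult_scaleR power2_eq_square)
    ultimately have "(1 / norm f)\<^sup>2 * (l * N f f) \<le> (1 / norm f)\<^sup>2 * D f f"
      by (simp add: mult_ac)
    then show ?thesis
      by (rule mult_left_le_imp_le) (use False in simp)
  qed (simp add: N_def D_def)
  have euler: "D f0 g = l * N f0 g" if "e \<bullet> g = 0" for g
  proof -
    have "0 \<le> 2 * s * (D f0 g - l * N f0 g) + s\<^sup>2 * (D g g - l * N g g)" for s
    proof -
      have "e \<bullet> (f0 + s *\<^sub>R g) = 0"
        using f0' that by (simp add: inner_add_right)
      from rayleigh[OF this] show ?thesis
        by (simp add: D_expand N_expand D_f0 algebra_simps)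
    qed
    then show ?thesis
      using quadratic_nonneg_imp_linear_zero by fastforce
  qed
  have G1: "G *v 1 = 0"
    using G(1) by (simp add: vec_eq_iff matrix_vector_mult_def markov_generator_def)
  have D1: "D h 1 = 0" for h
    by (simp add: D_def G1)
  have N1: "N h 1 = e \<bullet> h" for h
    by (simp add: N_def inner_vec_def mult_ac)
  have "- G *v f0 = l *s f0"
  proof -
    have "(- G *v f0) $ x = l * f0 $ x" for x
    proof -
      define c where "c = e $ x / (\<Sum>y\<in>UNIV. e $ y)"
      define g where "g = axis x 1 - c *\<^sub>R (1 :: real^'n)"
      have "0 < (\<Sum>y\<in>UNIV. e $ y)" using e by (intro sum_pos) auto
      then have "e \<bullet> g = 0"
        by (simp add: g_def c_def inner_diff_right inner_axis) (simp add: inner_vec_def)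
      from euler[OF this] have "D f0 g = l * N f0 g" .
      moreover have "D f0 g = D f0 (axis x 1) - c * D f0 1" "N f0 g = N f0 (axis x 1) - c * N f0 1"
        by (simp_all add: D_def N_def g_def inner_diff_right matrix_vector_mult_diff_distrib
            matrix_vector_mult_scaleR)
      ultimately have "D f0 (axis x 1) = l * N f0 (axis x 1)"
        by (simp add: D1 N1 f0')
      then have "D (axis x 1) f0 = l * N (axis x 1) f0"
        by (simp add: D_commute[of f0] N_commute[of f0])
      moreover have "(e * axis x 1) \<bullet> h = e $ x * h $ x" for h
        by (simp add: inner_vec_def axis_def if_distrib if_distribR cong: if_cong)
      ultimately have "e $ x * - (G *v f0) $ x = e $ x * (l * f0 $ x)"
        by (simp add: D_def N_def)
      then have "- (G *v f0) $ x = l * f0 $ x"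
        using e[of x] by (simp only: mult_cancel_left) simp
      then show ?thesis
        by (simp add: matrix_vector_mult_def sum_negf)
    qed
    then show ?thesis by (simp add: vec_eq_iff)
  qed
  then have ev: "eigenvalue (- G) l"
    using f0' by (auto simp: eigenvalue_def)
  have "l \<noteq> 0"
  proof
    assume "l = 0"
    then have "(e * f0) \<bullet> (G *v f0) = 0"
      using D_f0 by (simp add: D_def)
    then have const: "f0 $ x = f0 $ y" for x y
      by (rule dirichlet_form_zero_imp_constant[OF e sym G])
    obtain a where "f0 $ a \<noteq> 0"
      using f0'(1) by (metis vec_eq_iff zero_index)
    moreover have "(\<Sum>y\<in>UNIV. e $ y) * f0 $ a = e \<bullet> f0"
      unfolding inner_vec_def sum_distrib_right by (rule sum.cong) (auto simp: const[of a])
    moreover have "0 < (\<Sum>y\<in>UNIV. e $ y)" using e by (intro sum_pos) auto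
    ultimately show False using f0'(2) by simp
  qed
  have "spectral_gap G = l"
    unfolding spectral_gap_def
  proof (rule Least_equality)
    show "l \<noteq> 0 \<and> eigenvalue (- G) l" using ev \<open>l \<noteq> 0\<close> by simp
    fix k assume k: "k \<noteq> 0 \<and> eigenvalue (- G) k"
    then obtain v where v: "v \<noteq> 0" "- G *v v = k *s v"
      by (auto simp: eigenvalue_def)
    have Dv: "D h v = k * N h v" for h
    proof -
      have "D h v = (e * h) \<bullet> (- G *v v)"
        by (simp add: D_def inner_vec_def matrix_vector_mult_def sum_negf)
      then show ?thesis
        by (simp add: v(2) N_def inner_vec_def sum_distrib_left mult_ac)
    qed
    have "k * N 1 v = 0"
      using Dv[of 1] D1[of v] D_commute[of 1 v] by simp
    then have "e \<bullet> v = 0"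
      using k N1[of v] N_commute[of 1 v] by simp
    then have "l * N v v \<le> k * N v v"
      using rayleigh[of v] by (simp add: Dv)
    then show "l \<le> k"
      using N_pos[OF v(1)] by simp
  qed
  then show ?thesis
    using rayleigh[OF f] by (simp add: D_def N_def)
qed

lemma additive_symm_sym:
  assumes "\<And>x. 0 < e $ x"
  shows "e $ x * additive_symm e T $ x $ y = e $ y * additive_symm e T $ y $ x"
  using assms[of x] assms[of y]
  by (simp add: additive_symm_def adjoint_gen_def field_simps)

lemma markov_generator_additive_symm:
  assumes e: "\<And>x. 0 < e $ x" and T: "markov_generator T" "e v* T = 0"
  shows "markov_generator (additive_symm e T)"
proof -
  have "(\<Sum>y\<in>UNIV. e $ y / e $ x * T $ y $ x) = 0" for x
  proof -
    have "(\<Sum>y\<in>UNIV. e $ y / e $ x * T $ y $ x) = (e v* T) $ x / e $ x"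
      by (simp add: vector_matrix_mult_def sum_divide_distrib mult.commute)
    then show ?thesis using T(2) by simp
  qed
  then show ?thesis
    using T(1) less_imp_le[OF e]
    by (auto simp: markov_generator_def additive_symm_def adjoint_gen_def sum.distrib
        simp flip: sum_divide_distrib intro!: add_nonneg_nonneg)
qed

lemma irreducible_generator_additive_symm:
  assumes e: "\<And>x. 0 < e $ x" and T: "markov_generator T" "irreducible_generator T"
  shows "irreducible_generator (additive_symm e T)"
proof (rule irreducible_generator_mono[OF T(2)])
  fix x y :: 'a assume "x \<noteq> y" "0 < T $ x $ y"
  moreover have "0 \<le> e $ y / e $ x * T $ y $ x"
    using T(1) less_imp_le[OF e] \<open>x \<noteq> y\<close> by (auto simp: markov_generator_def)
  ultimately show "0 < additive_symm e T $ x $ y"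
    by (simp add: additive_symm_def adjoint_gen_def)
qed

lemma quadratic_form_additive_symm:
  fixes T :: "real^'n^'n"
  assumes e: "\<And>x. 0 < e $ x"
  shows "(e * u) \<bullet> (additive_symm e T *v u) = (e * u) \<bullet> (T *v u)"
proof -
  have form: "(e * u) \<bullet> (M *v u) = (\<Sum>x\<in>UNIV. \<Sum>y\<in>UNIV. e $ x * M $ x $ y * u $ x * u $ y)"
    for M :: "real^'n^'n"
    by (simp add: inner_vec_def matrix_vector_mult_def sum_distrib_left mult_ac)
  have "e $ x * adjoint_gen e T $ x $ y = e $ y * T $ y $ x" for x y
    using e[of x] by (simp add: adjoint_gen_def)
  then have "(e * u) \<bullet> (adjoint_gen e T *v u) = (\<Sum>x\<in>UNIV. \<Sum>y\<in>UNIV. e $ y * T $ y $ x * u $ x * u $ y)"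
    by (simp add: form)
  also have "\<dots> = (e * u) \<bullet> (T *v u)"
    by (subst sum.swap) (simp add: form mult_ac)
  finally have "(e * u) \<bullet> (adjoint_gen e T *v u) = (e * u) \<bullet> (T *v u)" .
  then show ?thesis
    by (simp add: additive_symm_def matrix_vector_mult_add_rdistrib inner_add_right
        flip: scaleR_matrix_vector_assoc)
qed

lemma L2_decay:
  fixes T :: "real^'n^'n" and u :: "real \<Rightarrow> real^'n"
  assumes card: "2 \<le> CARD('n)"
    and e: "\<And>x. 0 < e $ x"
    and T: "markov_generator T" "irreducible_generator T" "e v* T = 0"
    and u: "\<And>s x. ((\<lambda>s. u s $ x) has_real_derivative (T *v u s) $ x) (at s)"
    and u0: "e \<bullet> u 0 = 0"
    and t: "0 \<le> t"
  shows "(e * u t) \<bullet> u t \<le> (e * u 0) \<bullet> u 0 * exp (- 2 * spectral_gap (additive_symm e T) * t)"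
proof (rule gronwall[OF _ _ t])
  have "((\<lambda>s. e \<bullet> u s) has_real_derivative 0) (at s)" for s
  proof -
    have "((\<lambda>s. e \<bullet> u s) has_real_derivative e \<bullet> (T *v u s)) (at s)"
      unfolding inner_vec_def inner_real_def by (intro DERIV_sum DERIV_cmult u)
    then show ?thesis by (simp add: T(3) flip: dot_lmul_matrix)
  qed
  then have mean: "e \<bullet> u s = 0" for s
    using DERIV_isconst_all[of "\<lambda>s. e \<bullet> u s" s 0] u0 by simp
  show "((\<lambda>s. (e * u s) \<bullet> u s) has_real_derivative 2 * ((e * u s) \<bullet> (T *v u s))) (at s)" for s
  proof -
    have "((\<lambda>s. \<Sum>x\<in>UNIV. e $ x * (u s $ x)\<^sup>2) has_real_derivative
        (\<Sum>x\<in>UNIV. e $ x * (2 * u s $ x * (T *v u s) $ x))) (at s)"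
      by (intro DERIV_sum DERIV_cmult) (auto intro!: derivative_eq_intros u)
    then show ?thesis
      by (simp add: inner_vec_def power2_eq_square sum_distrib_left mult_ac)
  qed
  show "2 * ((e * u s) \<bullet> (T *v u s)) \<le> - 2 * spectral_gap (additive_symm e T) * ((e * u s) \<bullet> u s)"
    for s
    using spectral_gap_poincare[OF card e additive_symm_sym[OF e]
        markov_generator_additive_symm[OF e T(1,3)] irreducible_generator_additive_symm[OF e T(1,2)]
        mean[of s]]
    by (simp add: quadratic_form_additive_symm[OF e])
qed

subsection \<open>Doob's transform\<close>

lemma diag_mat_mult_vec: "diag_mat v *v f = v * f"
  by (simp add: vec_eq_iff matrix_vector_mult_def diag_mat_def if_distrib if_distribR cong: if_cong)

lemma vector_mult_diag_mat: "m v* diag_mat v = v * m"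
  by (simp add: vec_eq_iff vector_matrix_mult_def diag_mat_def if_distrib if_distribR cong: if_cong)

lemma doob_transform_nth:
  assumes h: "\<And>x. 0 < h $ x" "(L - diag_mat V) *v h = - l *\<^sub>R h"
  shows "doob_transform L h $ x $ y
    = ((L - diag_mat V) $ x $ y + (if x = y then l else 0)) * h $ y / h $ x"
proof (cases "x = y")
  case True
  have "((L - diag_mat V) *v h) $ x = (\<Sum>z\<in>UNIV. L $ x $ z * h $ z) - V $ x * h $ x"
    by (simp add: matrix_vector_mult_diff_rdistrib diag_mat_mult_vec)
      (simp add: matrix_vector_mult_def)
  then have "(\<Sum>z\<in>UNIV. L $ x $ z * h $ z) = (V $ x - l) * h $ x"
    unfolding h(2) by (simp add: left_diff_distrib)
  moreover have "(\<Sum>z\<in>UNIV. L $ x $ z * h $ z) = L $ x $ x * h $ x + (\<Sum>z\<in>UNIV - {x}. L $ x $ z * h $ z)"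
    by (simp add: sum.remove)
  ultimately have "(\<Sum>z\<in>UNIV - {x}. L $ x $ z * h $ z) = (V $ x - l - L $ x $ x) * h $ x"
    by (simp add: algebra_simps)
  then show ?thesis
    using True h(1)[of x]
    by (simp add: doob_transform_def diag_mat_def flip: sum_divide_distrib)
qed (simp add: doob_transform_def diag_mat_def)

lemma doob_transform_mult_vec:
  assumes h: "\<And>x. 0 < h $ x" "(L - diag_mat V) *v h = - l *\<^sub>R h"
  shows "(doob_transform L h *v u) $ x
    = ((L - diag_mat V) *v (h * u) + l *\<^sub>R (h * u)) $ x / h $ x"
proof -
  have "(doob_transform L h *v u) $ x = (\<Sum>y\<in>UNIV. ((L - diag_mat V) $ x $ y * (h * u) $ y
      + (if x = y then l * (h * u) $ x else 0)) / h $ x)"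
    unfolding matrix_vector_mult_def vec_lambda_beta doob_transform_nth[OF h]
    by (rule sum.cong) (auto simp: algebra_simps)
  also have "\<dots> = ((L - diag_mat V) *v (h * u) + l *\<^sub>R (h * u)) $ x / h $ x"
    by (simp add: matrix_vector_mult_def sum.distrib del: vector_minus_component
        flip: sum_divide_distrib)
  finally show ?thesis .
qed

lemma markov_generator_doob_transform:
  assumes "\<And>x. 0 < h $ x" "markov_generator G"
  shows "markov_generator (doob_transform G h)"
proof -
  have "(\<Sum>y\<in>UNIV. doob_transform G h $ x $ y) = 0" for x
    by (subst sum.remove[of _ x]) (auto simp: doob_transform_def intro!: sum.cong)
  then show ?thesis
    using assms less_imp_le[OF assms(1)]
    by (auto simp: markov_generator_def doob_transform_def)
qed

lemma irreducible_generator_doob_transform: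
  assumes "\<And>x. 0 < h $ x" "irreducible_generator G"
  shows "irreducible_generator (doob_transform G h)"
  by (rule irreducible_generator_mono[OF assms(2)]) (simp add: doob_transform_def assms(1))

subsection \<open>Quasi-stationary measures\<close>

lemma quasi_stationary_left_eigenvector:
  fixes A :: "real^'n^'n"
  assumes "quasi_stationary A m"
  shows "m v* A = (m \<bullet> (A *v 1)) *\<^sub>R m"
proof -
  have m: "m \<in> prob_measures" "\<And>t. 0 \<le> t \<Longrightarrow> cond_law A m t = m"
    using assms by (auto simp: quasi_stationary_def)
  have m1: "m \<bullet> 1 = 1"
    using m(1) by (simp add: prob_measures_def inner_vec_def)
  have der: "((\<lambda>s. m \<bullet> (mat_exp (s *\<^sub>R A) *v f)) has_real_derivative m \<bullet> (A *v f)) (at 0)" for f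
  proof -
    have "((\<lambda>s. m \<bullet> (mat_exp (s *\<^sub>R A) *v f)) has_real_derivative
        m \<bullet> (A *v (mat_exp (0 *\<^sub>R A) *v f))) (at 0)"
      unfolding inner_vec_def inner_real_def
      by (intro DERIV_sum DERIV_cmult has_real_derivative_mat_exp_mult_vec)
    then show ?thesis by (simp only: mat_exp_zero matrix_vector_mul_lid)
  qed
  have eig: "m \<bullet> (A *v f) = (m \<bullet> (A *v 1)) * (m \<bullet> f)" for f
  proof -
    define g where "g s = m \<bullet> (mat_exp (s *\<^sub>R A) *v f) - (m \<bullet> (mat_exp (s *\<^sub>R A) *v 1)) * (m \<bullet> f)" for s
    have "(g has_real_derivative m \<bullet> (A *v f) - (m \<bullet> (A *v 1)) * (m \<bullet> f)) (at 0)"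
      unfolding g_def by (intro DERIV_diff DERIV_cmult_right der)
    then have "((\<lambda>s. (g s - g 0) / s) \<longlongrightarrow> m \<bullet> (A *v f) - (m \<bullet> (A *v 1)) * (m \<bullet> f)) (at_right 0)"
      unfolding DERIV_def by (simp add: filterlim_at_split)
    moreover have g0: "g s = 0" if "0 \<le> s" for s
    proof -
      have eq: "(m \<bullet> (mat_exp (s *\<^sub>R A) *v f)) / (m \<bullet> (mat_exp (s *\<^sub>R A) *v 1)) = m \<bullet> f" for f
        using m(2)[OF that] cond_law_inner[of A m s f] by simp
      have "m \<bullet> (mat_exp (s *\<^sub>R A) *v 1) \<noteq> 0"
        using eq[of 1] m1 by auto
      with eq[of f] show ?thesis
        by (simp add: g_def field_simps)
    qed
    have "\<forall>\<^sub>F s in at_right 0. (g s - g 0) / s = 0"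
      unfolding eventually_at_right_field by (rule exI[of _ 1]) (simp add: g0)
    then have "((\<lambda>s. (g s - g 0) / s) \<longlongrightarrow> 0) (at_right 0)"
      by (rule tendsto_eventually)
    ultimately have "m \<bullet> (A *v f) - (m \<bullet> (A *v 1)) * (m \<bullet> f) = 0"
      by (intro tendsto_unique[OF trivial_limit_at_right_real])
    then show ?thesis by simp
  qed
  have "(m v* A - (m \<bullet> (A *v 1)) *\<^sub>R m) \<bullet> f = 0" for f
    by (simp add: inner_diff_left dot_lmul_matrix eig[of f])
  then show ?thesis
    by (metis eq_iff_diff_eq_0 inner_eq_zero_iff)
qed

lemma tv_norm_le:
  assumes "\<And>f. (\<And>x. \<bar>f $ x\<bar> \<le> 1) \<Longrightarrow> m \<bullet> f \<le> C"
  shows "tv_norm m \<le> C"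
proof -
  have "m \<bullet> (\<chi> x. sgn (m $ x)) \<le> C"
    by (rule assms) (simp add: abs_sgn_eq)
  then show ?thesis
    by (simp add: tv_norm_def inner_vec_def abs_sgn)
qed

theorem theorem2:
  fixes Lbar :: "real^('s::finite option)^('s option)"
    and L :: "real^'s^'s"
    and V \<nu> \<eta> \<phi> \<phi>s :: "real^'s"
    and l1 t :: real
  assumes card_S: "CARD('s) \<ge> 2"
    and Lbar: "markov_generator Lbar" "absorbing Lbar None"
    and V: "V = killing_rate Lbar"
    and L: "markov_generator L" "killed_block Lbar = L - diag_mat V" "irreducible_generator L"
    and nu: "quasi_stationary (L - diag_mat V) \<nu>"
    and lambda1: "principal_eigenvalue (diag_mat V - L) l1"
    and eta: "invariant_prob L \<eta>"
    and phi: "\<forall>x. 0 < \<phi> $ x" "(L - diag_mat V) *v \<phi> = - l1 *\<^sub>R \<phi>" "\<eta> \<bullet> (\<phi> * \<phi>) = 1"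
    and phis: "\<forall>x. 0 < \<phi>s $ x"
      "(adjoint_gen \<eta> L - diag_mat V) *v \<phi>s = - l1 *\<^sub>R \<phi>s" "\<eta> \<bullet> \<phi>s = 1"
    and t: "t \<ge> 0"
  shows "(SUP \<mu>0\<in>prob_measures. ereal (tv_norm (cond_law (L - diag_mat V) \<mu>0 t - \<nu>)))
    \<le> ereal (sqrt (\<eta> \<bullet> (\<phi> * \<phi>s) / vec_min (\<phi> * \<phi>s * \<eta>)) * (vec_max \<phi> / vec_min \<phi>) *
        exp (- spectral_gap (additive_symm (tilde_eta \<eta> \<phi> \<phi>s) (doob_transform L \<phi>)) * t))"
proof (rule SUP_least)
  fix \<mu>0 :: "real^'s"
  assume "\<mu>0 \<in> prob_measures"
  then have \<mu>0: "0 \<le> \<mu>0 $ x" "\<mu>0 \<bullet> 1 = 1" for x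
    by (simp_all add: prob_measures_def inner_vec_def)
  have \<nu>_prob: "0 \<le> \<nu> $ x" "\<nu> \<bullet> 1 = 1" for x
    using nu by (simp_all add: quasi_stationary_def prob_measures_def inner_vec_def)
  have \<eta>_prob: "0 \<le> \<eta> $ x" "\<eta> \<bullet> 1 = 1" for x
    using eta by (simp_all add: invariant_prob_def prob_measures_def inner_vec_def)
  define A where "A = L - diag_mat V"
  define E where "E s = mat_exp (s *\<^sub>R A)" for s
  define T where "T = doob_transform L \<phi>"
  define \<rho> where "\<rho> = \<phi>s * \<eta>"
  define Z where "Z = (\<Sum>y\<in>UNIV. \<phi> $ y * \<rho> $ y)"
  define e where "e = tilde_eta \<eta> \<phi> \<phi>s"
  define gap where "gap = spectral_gap (additive_symm e T)"

  have E0: "E 0 = mat 1"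
    unfolding E_def by (rule mat_exp_zero)
  have E_deriv: "((\<lambda>s. (E s *v h) $ x) has_real_derivative (A *v (E s *v h)) $ x) (at s)" for h x s
    unfolding E_def by (rule has_real_derivative_mat_exp_mult_vec)
  have A_off: "A $ x $ y = L $ x $ y" if "x \<noteq> y" for x y
    using that by (simp add: A_def diag_mat_def)
  have L_off: "0 \<le> L $ x $ y" if "x \<noteq> y" for x y
    using L(1) that by (simp add: markov_generator_def)
  have A_irr: "irreducible_generator A"
    by (rule irreducible_generator_mono[OF L(3)]) (simp add: A_off)
  have A\<phi>: "A *v \<phi> = - l1 *\<^sub>R \<phi>"
    using phi(2) by (simp add: A_def)

  have \<eta>_pos: "0 < \<eta> $ x" for x
  proof (rule ccontr)
    assume "\<not> 0 < \<eta> $ x"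
    then have "\<eta> $ x = 0"
      using \<eta>_prob(1)[of x] by simp
    moreover have "\<eta> v* L = 0 *\<^sub>R \<eta>"
      using eta by (simp add: invariant_prob_def)
    ultimately have "\<eta> = 0"
      using nonneg_left_eigenvector_zero[OF L(3) L_off] \<eta>_prob(1) by blast
    then show False using \<eta>_prob(2) by simp
  qed
  have \<rho>_pos: "0 < \<rho> $ x" for x
    using \<eta>_pos phis(1) by (simp add: \<rho>_def)
  have \<rho>_eigen: "\<rho> v* A = - l1 *\<^sub>R \<rho>"
  proof -
    have "(\<rho> v* A) $ x = - l1 * \<rho> $ x" for x
    proof -
      have "(\<Sum>y\<in>UNIV. \<eta> $ y / \<eta> $ x * L $ y $ x * \<phi>s $ y) - V $ x * \<phi>s $ x = - l1 * \<phi>s $ x"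
        using arg_cong[OF phis(2), of "\<lambda>w. w $ x"]
        by (simp add: matrix_vector_mult_diff_rdistrib diag_mat_mult_vec)
          (simp add: matrix_vector_mult_def adjoint_gen_def)
      then have "\<eta> $ x * (\<Sum>y\<in>UNIV. \<eta> $ y / \<eta> $ x * L $ y $ x * \<phi>s $ y)
          = \<eta> $ x * (V $ x * \<phi>s $ x - l1 * \<phi>s $ x)"
        by simp
      moreover have "\<eta> $ x * (\<Sum>y\<in>UNIV. \<eta> $ y / \<eta> $ x * L $ y $ x * \<phi>s $ y) = (\<rho> v* L) $ x"
        using \<eta>_pos[of x]
        by (simp add: \<rho>_def vector_matrix_mult_def sum_distrib_left mult_ac)
      moreover have "(\<rho> v* A) $ x = (\<rho> v* L) $ x - V $ x * \<rho> $ x"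
      proof -
        have "(\<rho> v* A) $ x = (\<rho> v* L) $ x - (\<rho> v* diag_mat V) $ x"
          by (simp add: A_def vector_matrix_mult_def right_diff_distrib sum_subtractf)
        then show ?thesis
          by (simp add: vector_mult_diag_mat)
      qed
      ultimately show ?thesis by (simp add: \<rho>_def algebra_simps)
    qed
    then show ?thesis by (simp add: vec_eq_iff)
  qed
  have \<phi>_mass: "0 < m \<bullet> \<phi>" if m: "\<And>x. 0 \<le> m $ x" "m \<bullet> 1 = 1" for m
  proof -
    obtain x where "m $ x \<noteq> 0"
      using m(2) by (metis inner_zero_left vec_eq_iff zero_index zero_neq_one)
    then show ?thesis
      unfolding inner_vec_def inner_real_def
      using m(1)[of x] phi(1) by (intro sum_pos2[of _ x] mult_nonneg_nonneg mult_pos_pos)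
        (auto simp: m less_imp_le less_le)
  qed
  obtain c where c: "\<nu> = c *\<^sub>R \<rho>"
  proof (rule nonneg_left_eigenvector_unique[OF A_irr _ _ \<rho>_pos \<rho>_eigen])
    show "0 \<le> A $ x $ y" if "x \<noteq> y" for x y
      using that A_off L_off by simp
    have eig: "\<nu> v* A = (\<nu> \<bullet> (A *v 1)) *\<^sub>R \<nu>"
      using nu unfolding A_def by (rule quasi_stationary_left_eigenvector)
    have "(\<nu> v* A) \<bullet> \<phi> = - l1 * (\<nu> \<bullet> \<phi>)"
      by (simp add: dot_lmul_matrix A\<phi>)
    then have "(\<nu> \<bullet> (A *v 1)) * (\<nu> \<bullet> \<phi>) = - l1 * (\<nu> \<bullet> \<phi>)"
      unfolding eig by simp
    then have "\<nu> \<bullet> (A *v 1) = - l1"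
      using \<phi>_mass[OF \<nu>_prob] by (metis less_irrefl mult_right_cancel)
    then show "\<nu> v* A = - l1 *\<^sub>R \<nu>"
      using eig by simp
  qed

  have Z_pos: "0 < Z"
    unfolding Z_def using phi(1) \<rho>_pos by (intro sum_pos) auto
  have Z_eq: "Z = \<eta> \<bullet> (\<phi> * \<phi>s)"
    by (simp add: Z_def \<rho>_def inner_vec_def mult_ac)
  have e_nth: "e $ x = \<phi> $ x * \<rho> $ x / Z" for x
    by (simp add: e_def tilde_eta_def Z_def \<rho>_def mult_ac)
  have e_pos: "0 < e $ x" for x
    using phi(1) \<rho>_pos Z_pos by (simp add: e_nth)
  have T_mult: "(T *v u) $ x = (A *v (\<phi> * u) + l1 *\<^sub>R (\<phi> * u)) $ x / \<phi> $ x" for u x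
    unfolding T_def A_def by (rule doob_transform_mult_vec) (use phi in auto)
  have T_inv: "e v* T = 0"
  proof -
    have "(e v* T) \<bullet> u = 0" for u
    proof -
      have "(e v* T) \<bullet> u = (\<rho> \<bullet> (A *v (\<phi> * u) + l1 *\<^sub>R (\<phi> * u))) / Z"
      proof -
        have "e $ x * (T *v u) $ x = \<rho> $ x * (A *v (\<phi> * u) + l1 *\<^sub>R (\<phi> * u)) $ x / Z" for x
          using phi(1)[rule_format, of x] unfolding T_mult e_nth by simp
        then have "e \<bullet> (T *v u) = (\<rho> \<bullet> (A *v (\<phi> * u) + l1 *\<^sub>R (\<phi> * u))) / Z"
          unfolding inner_vec_def inner_real_def by (simp only: sum_divide_distrib)
        then show ?thesis by (simp only: dot_lmul_matrix)
      qed
      then show ?thesis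
        by (simp add: inner_add_right \<rho>_eigen flip: dot_lmul_matrix)
    qed
    then show ?thesis by (metis inner_eq_zero_iff)
  qed
  have T: "markov_generator T" "irreducible_generator T"
    unfolding T_def using phi(1) L(1,3)
    by (simp_all add: markov_generator_doob_transform irreducible_generator_doob_transform)

  define pmin where "pmin = vec_min \<phi>"
  define pmax where "pmax = vec_max \<phi>"
  have pmin_le: "pmin \<le> \<phi> $ x" and le_pmax: "\<phi> $ x \<le> pmax" for x
    unfolding pmin_def pmax_def vec_min_def vec_max_def by auto
  have pmin_pos: "0 < pmin"
    using phi(1) by (simp add: pmin_def vec_min_def)
  have pmax_pos: "0 < pmax"
    using pmin_pos pmin_le le_pmax by (meson less_le_trans)
  define emin where "emin = vec_min (\<phi> * \<phi>s * \<eta>) / Z"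
  have vmin_pos: "0 < vec_min (\<phi> * \<phi>s * \<eta>)"
    using phi(1) phis(1) \<eta>_pos by (simp add: vec_min_def)
  then have emin_pos: "0 < emin"
    using Z_pos by (simp add: emin_def)
  have emin_le: "emin \<le> e $ x" for x
  proof -
    have "vec_min (\<phi> * \<phi>s * \<eta>) \<le> (\<phi> * \<phi>s * \<eta>) $ x"
      unfolding vec_min_def by (intro Min_le) auto
    then show ?thesis
      using Z_pos by (simp add: emin_def e_nth \<rho>_def divide_right_mono mult_ac)
  qed

  have E1_ge: "exp (- l1 * t) * \<phi> $ x \<le> pmax * (E t *v 1) $ x" for x
  proof -
    define z where "z s = (pmax * exp (l1 * s)) *\<^sub>R (E s *v 1) - \<phi>" for s
    define B where "B = A + l1 *\<^sub>R mat 1"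
    have B_mult: "B *v w = A *v w + l1 *\<^sub>R w" for w
      by (simp add: B_def matrix_vector_mult_add_rdistrib flip: scaleR_matrix_vector_assoc)
    have "((\<lambda>s. z s $ y) has_real_derivative (B *v z s) $ y) (at s)" for s y
    proof -
      have "((\<lambda>s. z s $ y) has_real_derivative
          pmax * (l1 * exp (l1 * s)) * (E s *v 1) $ y + pmax * exp (l1 * s) * (A *v (E s *v 1)) $ y) (at s)"
        unfolding z_def
        by (auto intro!: derivative_eq_intros E_deriv simp: algebra_simps)
      moreover have "B *v z s = (pmax * exp (l1 * s)) *\<^sub>R (A *v (E s *v 1) + l1 *\<^sub>R (E s *v 1))"
        by (simp add: B_mult z_def matrix_vector_mult_diff_distrib matrix_vector_mult_scaleR A\<phi> algebra_simps)
      ultimately show ?thesis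
        by (simp add: algebra_simps)
    qed
    then have "0 \<le> z t $ x"
    proof (rule linear_ode_nonneg[OF _ _ _ t])
      show "0 \<le> B $ x $ y" if "x \<noteq> y" for x y
        using that A_off L_off by (simp add: B_def mat_def)
      show "0 \<le> z 0 $ y" for y
        using le_pmax[of y] by (simp add: z_def E0)
    qed
    then have "exp (- l1 * t) * \<phi> $ x \<le> exp (- l1 * t) * (pmax * exp (l1 * t) * (E t *v 1) $ x)"
      by (intro mult_left_mono) (auto simp: z_def)
    also have "\<dots> = pmax * (E t *v 1) $ x"
      by (simp add: exp_minus)
    finally show ?thesis .
  qed
  have mass_ge: "exp (- l1 * t) * (\<mu>0 \<bullet> \<phi>) \<le> pmax * (\<mu>0 \<bullet> (E t *v 1))"
  proof -
    have "(\<Sum>x\<in>UNIV. \<mu>0 $ x * (exp (- l1 * t) * \<phi> $ x)) \<le> (\<Sum>x\<in>UNIV. \<mu>0 $ x * (pmax * (E t *v 1) $ x))"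
      by (intro sum_mono mult_left_mono E1_ge \<mu>0)
    then show ?thesis
      by (simp add: inner_vec_def sum_distrib_left mult_ac)
  qed
  have mass_pos: "0 < \<mu>0 \<bullet> (E t *v 1)"
    using \<phi>_mass[OF \<mu>0] pmax_pos mass_ge
    by (metis exp_gt_zero less_le_trans mult_pos_pos zero_less_mult_pos)

  have "tv_norm (cond_law A \<mu>0 t - \<nu>) \<le> sqrt (1 / emin) * (pmax / pmin) * exp (- gap * t)"
  proof (rule tv_norm_le)
    fix f :: "real^'s"
    assume f: "\<And>x. \<bar>f $ x\<bar> \<le> 1"
    define h where "h = f - (\<nu> \<bullet> f) *\<^sub>R 1"
    define u where "u s = (\<chi> x. exp (l1 * s) * (E s *v h) $ x / \<phi> $ x)" for s
    have \<phi>u: "\<phi> * u s = exp (l1 * s) *\<^sub>R (E s *v h)" for s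
      using phi(1) by (simp add: u_def vec_eq_iff less_imp_neq[symmetric])
    have \<nu>h: "\<nu> \<bullet> h = 0"
      by (simp add: h_def inner_diff_right \<nu>_prob)
    have u_deriv: "((\<lambda>s. u s $ x) has_real_derivative (T *v u s) $ x) (at s)" for s x
    proof -
      have "((\<lambda>s. u s $ x) has_real_derivative
          (l1 * exp (l1 * s) * (E s *v h) $ x + exp (l1 * s) * (A *v (E s *v h)) $ x) / \<phi> $ x) (at s)"
        unfolding u_def vec_lambda_beta
        by (intro DERIV_cdivide) (auto intro!: derivative_eq_intros E_deriv simp: algebra_simps)
      then show ?thesis
        by (simp add: T_mult \<phi>u matrix_vector_mult_scaleR algebra_simps)
    qed
    have c\<phi>: "c * Z = \<nu> \<bullet> \<phi>"
      by (simp add: c Z_def inner_vec_def sum_distrib_left mult_ac)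
    have pmin_cZ: "pmin \<le> c * Z"
    proof -
      have "(\<Sum>x\<in>UNIV. \<nu> $ x * pmin) \<le> (\<Sum>x\<in>UNIV. \<nu> $ x * \<phi> $ x)"
        by (intro sum_mono mult_left_mono pmin_le \<nu>_prob)
      then show ?thesis
        using \<nu>_prob(2) by (simp add: c\<phi> inner_vec_def flip: sum_distrib_right)
    qed
    have c_pos: "0 < c"
      using pmin_cZ pmin_pos Z_pos by (metis less_le_trans zero_less_mult_pos2)
    have e_\<nu>: "e $ x = \<phi> $ x * \<nu> $ x / (c * Z)" for x
      using c_pos by (simp add: e_nth c)
    have u0: "u 0 $ x = h $ x / \<phi> $ x" for x
      by (simp add: u_def E0)
    have "e $ x * u 0 $ x = \<nu> $ x * h $ x / (c * Z)" for x
      using phi(1)[rule_format, of x] by (simp add: e_\<nu> u0)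
    then have "e \<bullet> u 0 = (\<nu> \<bullet> h) / (c * Z)"
      by (simp add: inner_vec_def sum_divide_distrib)
    then have "e \<bullet> u 0 = 0"
      by (simp add: \<nu>h)
    then have decay: "(e * u t) \<bullet> u t \<le> (e * u 0) \<bullet> u 0 * exp (- 2 * gap * t)"
      unfolding gap_def by (intro L2_decay card_S e_pos T T_inv u_deriv t)
    have "(\<Sum>x\<in>UNIV. \<nu> $ x * (h $ x)\<^sup>2) \<le> 1"
    proof -
      have "(\<Sum>x\<in>UNIV. \<nu> $ x * (h $ x)\<^sup>2) = (\<Sum>x\<in>UNIV. \<nu> $ x * (f $ x)\<^sup>2) - (\<nu> \<bullet> f)\<^sup>2"
      proof -
        have "(\<Sum>x\<in>UNIV. \<nu> $ x * (h $ x)\<^sup>2)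
            = (\<Sum>x\<in>UNIV. \<nu> $ x * (f $ x)\<^sup>2) - 2 * (\<nu> \<bullet> f) * (\<nu> \<bullet> f) + (\<nu> \<bullet> f)\<^sup>2 * (\<nu> \<bullet> 1)"
          by (simp add: h_def power2_diff inner_vec_def[of \<nu> f] inner_vec_def[of \<nu> 1] sum.distrib
              sum_subtractf sum_distrib_left distrib_left right_diff_distrib mult_ac)
            (simp add: sum_distrib_right)
        then show ?thesis
          by (simp add: \<nu>_prob power2_eq_square)
      qed
      also have "\<dots> \<le> (\<Sum>x\<in>UNIV. \<nu> $ x * 1)"
      proof -
        have "(\<Sum>x\<in>UNIV. \<nu> $ x * (f $ x)\<^sup>2) \<le> (\<Sum>x\<in>UNIV. \<nu> $ x * 1)"
          using f by (intro sum_mono mult_left_mono \<nu>_prob) (simp add: abs_square_le_1)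
        then show ?thesis by (smt (verit) zero_le_power2)
      qed
      finally show ?thesis
        using \<nu>_prob(2) by (simp add: inner_vec_def)
    qed
    moreover have "(e * u 0) \<bullet> u 0 \<le> (\<Sum>x\<in>UNIV. \<nu> $ x * (h $ x)\<^sup>2) / pmin\<^sup>2"
    proof -
      text \<open>One factor \<open>\<phi>\<close> is absorbed by \<open>e = \<phi> \<nu> / \<nu>[\<phi>]\<close>, and the normalisation supplies the other \<open>1 / min \<phi>\<close>.\<close>
      have "e $ x * u 0 $ x * u 0 $ x \<le> \<nu> $ x * (h $ x)\<^sup>2 / pmin\<^sup>2" for x
      proof -
        have "e $ x * u 0 $ x * u 0 $ x = \<nu> $ x * (h $ x)\<^sup>2 / (\<phi> $ x * (c * Z))"
          using phi(1)[rule_format, of x] by (simp add: e_\<nu> u0 power2_eq_square mult_ac)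
        also have "\<dots> \<le> \<nu> $ x * (h $ x)\<^sup>2 / (pmin * pmin)"
          using pmin_pos c_pos Z_pos pmin_le[of x] pmin_cZ \<nu>_prob(1)[of x]
          by (intro divide_left_mono mult_mono) (auto intro!: mult_pos_pos phi(1)[rule_format])
        finally show ?thesis by (simp add: power2_eq_square)
      qed
      then show ?thesis
        by (auto simp: inner_vec_def sum_divide_distrib intro: sum_mono)
    qed
    ultimately have N0: "(e * u 0) \<bullet> u 0 \<le> 1 / pmin\<^sup>2"
      using pmin_pos by (smt (verit) divide_right_mono zero_le_power2)
    define U where "U = sqrt (1 / emin) * (1 / pmin) * exp (- gap * t)"
    have U: "\<bar>u t $ x\<bar> \<le> U" for x
    proof -
      have "emin * (u t $ x)\<^sup>2 \<le> e $ x * (u t $ x)\<^sup>2"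
        by (intro mult_right_mono emin_le) simp
      also have "\<dots> \<le> (\<Sum>x\<in>UNIV. e $ x * (u t $ x)\<^sup>2)"
        by (rule member_le_sum) (auto simp: less_imp_le[OF e_pos])
      also have "\<dots> = (e * u t) \<bullet> u t"
        by (simp add: inner_vec_def power2_eq_square mult_ac)
      also have "\<dots> \<le> 1 / pmin\<^sup>2 * exp (- 2 * gap * t)"
        by (rule order_trans[OF decay mult_right_mono[OF N0]]) simp
      finally have "(u t $ x)\<^sup>2 * emin \<le> 1 / pmin\<^sup>2 * exp (- 2 * gap * t)"
        by (simp only: mult.commute)
      then have "(u t $ x)\<^sup>2 \<le> 1 / pmin\<^sup>2 * exp (- 2 * gap * t) / emin"
        using emin_pos by (simp only: pos_le_divide_eq)
      also have "\<dots> = U\<^sup>2"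
      proof -
        have "exp (- 2 * gap * t) = (exp (- gap * t))\<^sup>2"
          by (simp flip: exp_double)
        moreover have "(sqrt (1 / emin))\<^sup>2 = 1 / emin"
          using emin_pos by (intro real_sqrt_pow2) simp
        ultimately show ?thesis
          unfolding U_def power_mult_distrib by (simp add: power_divide)
      qed
      finally show ?thesis
        using emin_pos pmin_pos by (intro power2_le_imp_le[of "\<bar>u t $ x\<bar>"]) (auto simp: U_def)
    qed
    have "(cond_law A \<mu>0 t - \<nu>) \<bullet> f = (\<mu>0 \<bullet> (E t *v h)) / (\<mu>0 \<bullet> (E t *v 1))"
      using mass_pos
      by (simp add: inner_diff_left cond_law_inner h_def matrix_vector_mult_diff_distrib
          matrix_vector_mult_scaleR inner_diff_right diff_divide_distrib flip: E_def)
    also have "\<dots> \<le> pmax * U"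
    proof -
      have "E t *v h = exp (- l1 * t) *\<^sub>R (\<phi> * u t)"
        by (simp add: \<phi>u exp_minus)
      then have "\<mu>0 \<bullet> (E t *v h) = exp (- l1 * t) * (\<Sum>x\<in>UNIV. \<mu>0 $ x * (\<phi> $ x * u t $ x))"
        by (simp add: inner_vec_def sum_distrib_left mult_ac)
      also have "\<dots> \<le> exp (- l1 * t) * (\<Sum>x\<in>UNIV. \<mu>0 $ x * (\<phi> $ x * U))"
        using U phi(1) by (intro mult_left_mono sum_mono \<mu>0) (auto simp: abs_le_iff less_imp_le)
      also have "\<dots> = exp (- l1 * t) * (\<mu>0 \<bullet> \<phi>) * U"
        by (simp add: inner_vec_def sum_distrib_right mult.assoc)
      also have "\<dots> \<le> pmax * (\<mu>0 \<bullet> (E t *v 1)) * U"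
        using emin_pos pmin_pos by (intro mult_right_mono mass_ge) (simp add: U_def)
      finally show ?thesis
        using mass_pos by (simp add: pos_divide_le_eq mult_ac)
    qed
    also have "\<dots> = sqrt (1 / emin) * (pmax / pmin) * exp (- gap * t)"
      by (simp add: U_def)
    finally show "(cond_law A \<mu>0 t - \<nu>) \<bullet> f \<le> sqrt (1 / emin) * (pmax / pmin) * exp (- gap * t)" .
  qed
  moreover have "1 / emin = \<eta> \<bullet> (\<phi> * \<phi>s) / vec_min (\<phi> * \<phi>s * \<eta>)"
    by (simp add: emin_def Z_eq)
  ultimately show "ereal (tv_norm (cond_law (L - diag_mat V) \<mu>0 t - \<nu>))
    \<le> ereal (sqrt (\<eta> \<bullet> (\<phi> * \<phi>s) / vec_min (\<phi> * \<phi>s * \<eta>)) * (vec_max \<phi> / vec_min \<phi>) *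
        exp (- spectral_gap (additive_symm (tilde_eta \<eta> \<phi> \<phi>s) (doob_transform L \<phi>)) * t))"
    by (simp add: A_def gap_def e_def T_def pmin_def pmax_def)
qed

end
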